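(* Let $\lambda\in\mathbb{R}^m_+$, $\rho>0$, $\kappa=\rho\|A\|_2^2$, and let $\{x^t\}$ be a sequence generated by block coordinate descent with the proximal linear update with step size $\tau$, starting from $x^0\in\mathcal{X}$. If the step size satisfies $0<\tau<\frac{1}{2\kappa}$, then: (i) The sequence $\{L(x^t,\lambda,\rho)\}$ is nonincreasing and $$\frac{\kappa}{2}\|x^{t+1}-x^t\|^2\le L(x^t,\lambda,\rho)-L(x^{t+1},\lambda,\rho).$$ (ii) The sequence $\{x^t\}$ converges to a $\tau$-stationary point after at most $\left\lceil\frac{2C\sqrt n+\kappa n}{\kappa}\right\rceil$ iterations, where $C=\max_{x\in\mathcal{X}}\|\nabla L(x,\lambda,\rho)\|$.
   Context: Problem data: $n=\sum_{j=1}^p n_j$, $c=(c_1;\dots;c_p)\in\mathbb{R}^n$, $A=(A_1\ \cdots\ A_p)\in\mathbb{R}^{m\times n}$ with $A_j\in\mathbb{R}^{m\times n_j}$, $b\in\mathbb{R}^m$, $x=(x_1;\dots;x_p)$, and $\mathcal{X}=\mathcal{X}_1\times\dots\times\mathcal{X}_p\neq\emptyset$ with $\mathcal{X}_j=\{x_j\in\{0,1\}^{n_j}: B_jx_j\le d_j\}$ for given real $B_j,d_j$. $\|\cdot\|$ is the Euclidean norm, $\|A\|_2$ the spectral norm, $\mathbf{1}$ the all-ones vector. The augmented Lagrangian is $L(x,\lambda,\rho)=c^{\top}x+\lambda^{\top}(Ax-b)+\frac{\rho}{2}\|(Ax-b)_+\|^2$, with $(\cdot)_+$ the componentwise positive part;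 $\nabla L$ is its gradient in $x$, and $g(x)=\nabla L(x,\lambda,\rho)=c+A^{\top}\lambda+\rho A^{\top}(Ax-b)_+$. Block coordinate descent with the proximal linear update: given $x^t$, for $j=1,\dots,p$ in order set $x^t(j)=(x_1^{t+1};\dots;x_{j-1}^{t+1};x_j^t;x_{j+1}^t;\dots;x_p^t)$ and $g_j(x^t)=\nabla_{x_j}L(x^t(j),\lambda,\rho)=c_j+A_j^{\top}\lambda+\rho A_j^{\top}(Ax^t(j)-b)_+$, and choose $$x_j^{t+1}\in\arg\min_{x_j\in\mathcal{X}_j}\Big\{\langle x_j-x_j^t,g_j(x^t)\rangle+\frac{1}{2\tau}\|x_j-x_j^t\|^2\Big\}.$$ For a nonempty closed set $\Omega$, $\mathcal{T}_\Omega(v)=\arg\min_{u\in\Omega}v^{\top}u$; $x=\mathcal{T}_\Omega(v)$ means that $x\in\Omega$ attains this minimum. A point $x^*$ is a $\tau$-stationary point of $\min_{x\in\mathcal{X}}L(x,\lambda,\rho)$ if $x^*=\mathcal{T}_{\mathcal{X}}\big(\tau g(x^* )+\frac{\mathbf{1}}{2}-x^*\big)$.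
   Formalization: With tied minimizers the sequence may rest and move later, so (ii) fails literally; proved: it converges to a τ-stationary point, at most N iterations move, a resting τ-stationary iterate occurs by index N, and x^t is the limit for t≥N if a resting sequence stays at rest (N: the stated bound). *)

theory Defs
  imports "HOL-Analysis.Analysis"
begin

text \<open>
  The index type \<open>'n\<close> plays the role of \<open>{1..n}\<close> and \<open>blk i \<in> {1..p}\<close> is the block of
  coordinate \<open>i\<close>, so \<open>n\<^sub>j = card {i. blk i = j}\<close>; blocks need not consist of consecutive
  coordinates.  Since the \<open>n\<^sub>j\<close> differ, a block vector \<open>x\<^sub>j\<close> is represented by its
  zero-padding in \<open>real ^ 'n\<close>, which preserves inner products and norms.
\<close>

definition blockpart :: "('n::finite \<Rightarrow> nat) \<Rightarrow> nat \<Rightarrow> real ^ 'n \<Rightarrow> real ^ 'n" where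
  "blockpart blk j x = (\<chi> i. if blk i = j then x $ i else 0)"

text \<open>
  The matrix \<open>B\<^sub>j\<close> has \<open>q j\<close> rows, row \<open>r\<close> being \<open>B j r\<close>; its entries outside the columns of
  block \<open>j\<close> are multiplied by zero and hence irrelevant.
\<close>

definition block_feasible ::
  "('n::finite \<Rightarrow> nat) \<Rightarrow> (nat \<Rightarrow> nat) \<Rightarrow> (nat \<Rightarrow> nat \<Rightarrow> real ^ 'n) \<Rightarrow> (nat \<Rightarrow> nat \<Rightarrow> real)
    \<Rightarrow> nat \<Rightarrow> (real ^ 'n) set" where
  "block_feasible blk q B d j =
    {u. (\<forall>i. blk i = j \<longrightarrow> u $ i \<in> {0, 1}) \<and> (\<forall>i. blk i \<noteq> j \<longrightarrow> u $ i = 0) \<and>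
        (\<forall>r<q j. B j r \<bullet> u \<le> d j r)}"

definition feasible ::
  "('n::finite \<Rightarrow> nat) \<Rightarrow> nat \<Rightarrow> (nat \<Rightarrow> nat) \<Rightarrow> (nat \<Rightarrow> nat \<Rightarrow> real ^ 'n) \<Rightarrow> (nat \<Rightarrow> nat \<Rightarrow> real)
    \<Rightarrow> (real ^ 'n) set" where
  "feasible blk p q B d = {x. \<forall>j\<in>{1..p}. blockpart blk j x \<in> block_feasible blk q B d j}"

definition pos_part :: "real ^ 'm \<Rightarrow> real ^ 'm" where
  "pos_part v = (\<chi> i. max 0 (v $ i))"

definition aug_lagrangian ::
  "real ^ 'n \<Rightarrow> real ^ 'n ^ 'm \<Rightarrow> real ^ 'm \<Rightarrow> real ^ 'm \<Rightarrow> real \<Rightarrow> real ^ 'n \<Rightarrow> real" where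
  "aug_lagrangian c A b lam rho x =
    c \<bullet> x + lam \<bullet> (A *v x - b) + rho / 2 * (norm (pos_part (A *v x - b)))\<^sup>2"

definition grad :: "('a::real_inner \<Rightarrow> real) \<Rightarrow> 'a \<Rightarrow> 'a" where
  "grad f x = (THE D. GDERIV f x :> D)"

definition spectral_norm :: "real ^ 'n ^ 'm \<Rightarrow> real" where
  "spectral_norm A = onorm (\<lambda>x. A *v x)"

text \<open>\<open>x\<^sup>t(j)\<close>: blocks before \<open>j\<close> are taken from the new iterate \<open>y\<close>, the others from \<open>x\<close>.\<close>

definition partial_update ::
  "('n::finite \<Rightarrow> nat) \<Rightarrow> nat \<Rightarrow> real ^ 'n \<Rightarrow> real ^ 'n \<Rightarrow> real ^ 'n" where
  "partial_update blk j y x = (\<chi> i. if blk i < j then y $ i else x $ i)"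

text \<open>
  A sequence generated by block coordinate descent for \<open>F\<close> over \<open>S 1 \<times> \<dots> \<times> S p\<close> with the proximal
  linear update; any minimizer may be selected in each block subproblem.  The partial gradient
  of \<open>F\<close> in \<open>x\<^sub>j\<close> is block \<open>j\<close> of the gradient.
\<close>

definition bcd_prox_linear ::
  "('n::finite \<Rightarrow> nat) \<Rightarrow> nat \<Rightarrow> (nat \<Rightarrow> (real ^ 'n) set) \<Rightarrow> (real ^ 'n \<Rightarrow> real) \<Rightarrow> real
    \<Rightarrow> (nat \<Rightarrow> real ^ 'n) \<Rightarrow> bool" where
  "bcd_prox_linear blk p S F tau x \<longleftrightarrow>
    (\<forall>t. \<forall>j\<in>{1..p}.
      is_arg_min
        (\<lambda>u. (u - blockpart blk j (x t)) \<bullet>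
               blockpart blk j (grad F (partial_update blk j (x (Suc t)) (x t)))
             + 1 / (2 * tau) * (norm (u - blockpart blk j (x t)))\<^sup>2)
        (\<lambda>u. u \<in> S j)
        (blockpart blk j (x (Suc t))))"

definition linear_argmin :: "'a::real_inner set \<Rightarrow> 'a \<Rightarrow> 'a set" where
  "linear_argmin \<Omega> v = {x. is_arg_min (\<lambda>u. v \<bullet> u) (\<lambda>u. u \<in> \<Omega>) x}"

definition tau_stationary ::
  "(real ^ 'n \<Rightarrow> real) \<Rightarrow> (real ^ 'n) set \<Rightarrow> real \<Rightarrow> real ^ 'n \<Rightarrow> bool" where
  "tau_stationary F X tau x \<longleftrightarrow>
    x \<in> linear_argmin X (tau *\<^sub>R grad F x + (1 / 2) *\<^sub>R 1 - x)"

lemma grad_eqI: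
  assumes "GDERIV f x :> D"
  shows "grad f x = D"
  unfolding grad_def
proof (rule the_equality[where P = "\<lambda>D. GDERIV f x :> D"])
  show "GDERIV f x :> D" by (rule assms)
  fix E assume "GDERIV f x :> E"
  then have "(\<lambda>h. h \<bullet> E) = (\<lambda>h. h \<bullet> D)"
    using assms has_derivative_unique unfolding gderiv_def by blast
  then have "(E - D) \<bullet> (E - D) = 0" by (metis inner_diff_right right_minus_eq)
  then show "E = D" by simp
qed

lemma DERIV_half_pos_square: "((\<lambda>y::real. (max 0 y)\<^sup>2 / 2) has_real_derivative max 0 y) (at y)"
proof -
  consider "y > 0" | "y < 0" | "y = 0" by linarith
  then show ?thesis
  proof cases
    case 1
    have "((\<lambda>y::real. y\<^sup>2 / 2) has_real_derivative max 0 y) (at y)"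
      using 1 by (auto intro!: derivative_eq_intros)
    then show ?thesis
      by (rule has_field_derivative_transform_within_open[of _ _ _ "{0<..}"]) (use 1 in auto)
  next
    case 2
    have "((\<lambda>y::real. 0) has_real_derivative max 0 y) (at y)"
      using 2 by (auto intro!: derivative_eq_intros)
    then show ?thesis
      by (rule has_field_derivative_transform_within_open[of _ _ _ "{..<0}"]) (use 2 in auto)
  next
    case 3
    have "((\<lambda>h::real. (max 0 h)\<^sup>2 / 2 / h) \<longlongrightarrow> 0) (at 0)"
    proof (rule Lim_null_comparison)
      show "\<forall>\<^sub>F h in at (0::real). norm ((max 0 h)\<^sup>2 / 2 / h) \<le> \<bar>h\<bar>"
        by (rule always_eventually) (auto simp: max_def power2_eq_square)
      show "((\<lambda>h::real. \<bar>h\<bar>) \<longlongrightarrow> 0) (at 0)"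
        by (rule tendsto_rabs_zero) (rule tendsto_ident_at)
    qed
    then show ?thesis using 3 by (simp add: DERIV_def)
  qed
qed

lemma GDERIV_aug_lagrangian:
  fixes A :: "real ^ 'n ^ 'm"
  shows "GDERIV (aug_lagrangian c A b lam rho) x :>
    c + transpose A *v lam + rho *\<^sub>R (transpose A *v pos_part (A *v x - b))"
proof -
  have comp: "((\<lambda>x. (max 0 ((A *v x - b) $ i))\<^sup>2 / 2) has_derivative
      (\<lambda>h. (A *v h) $ i * max 0 ((A *v x - b) $ i))) (at x)" for i
  proof -
    have "((\<lambda>x. (A *v x - b) $ i) has_derivative (\<lambda>h. (A *v h) $ i)) (at x)"
      by (auto intro!: derivative_eq_intros bounded_linear.has_derivative[OF bounded_linear_vec_nth]
          bounded_linear.has_derivative[OF matrix_vector_mul_bounded_linear])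
    from DERIV_compose_FDERIV[OF DERIV_half_pos_square this] show ?thesis .
  qed
  have sq: "(norm (pos_part v))\<^sup>2 = (\<Sum>i\<in>UNIV. (max 0 (v $ i))\<^sup>2)" for v :: "real ^ 'm"
    unfolding power2_norm_eq_inner by (simp add: inner_vec_def pos_part_def power2_eq_square)
  have eq: "aug_lagrangian c A b lam rho =
      (\<lambda>x. c \<bullet> x + lam \<bullet> (A *v x - b) + rho * (\<Sum>i\<in>UNIV. (max 0 ((A *v x - b) $ i))\<^sup>2 / 2))"
    by (rule ext) (simp add: aug_lagrangian_def sq sum_divide_distrib[symmetric] del: vector_minus_component)
  have lin: "((\<lambda>x. A *v x - b) has_derivative (\<lambda>h. A *v h)) (at x)"
    by (auto intro!: derivative_eq_intros
        bounded_linear.has_derivative[OF matrix_vector_mul_bounded_linear])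
  have "(aug_lagrangian c A b lam rho has_derivative
      (\<lambda>h. c \<bullet> h + lam \<bullet> (A *v h)
        + rho * (\<Sum>i\<in>UNIV. (A *v h) $ i * max 0 ((A *v x - b) $ i)))) (at x)"
    unfolding eq
    by (intro has_derivative_add has_derivative_mult_right has_derivative_sum comp
        has_derivative_inner_right lin has_derivative_ident)
  moreover have "c \<bullet> h + lam \<bullet> (A *v h)
        + rho * (\<Sum>i\<in>UNIV. (A *v h) $ i * max 0 ((A *v x - b) $ i)) =
      h \<bullet> (c + transpose A *v lam + rho *\<^sub>R (transpose A *v pos_part (A *v x - b)))" for h
  proof -
    have "(\<Sum>i\<in>UNIV. (A *v h) $ i * max 0 ((A *v x - b) $ i))
        = (A *v h) \<bullet> pos_part (A *v x - b)"
      by (simp add: inner_vec_def pos_part_def)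
    moreover have "(A *v h) \<bullet> v = h \<bullet> (transpose A *v v)" for v
      using dot_lmul_matrix[of v A h] by (simp add: inner_commute)
    ultimately show ?thesis by (simp add: inner_add_right inner_commute)
  qed
  ultimately show ?thesis unfolding gderiv_def by simp
qed

lemma grad_aug_lagrangian:
  "grad (aug_lagrangian c A b lam rho) x =
    c + transpose A *v lam + rho *\<^sub>R (transpose A *v pos_part (A *v x - b))"
  by (rule grad_eqI) (rule GDERIV_aug_lagrangian)

end

theory Submission
  imports Defs
begin

text \<open>
  The gradient of the augmented Lagrangian \<open>L\<close> is Lipschitz with constant \<open>kappa\<close>, so \<open>L\<close> lies
  below its quadratic model: \<open>L y \<le> L x + (y - x) \<bullet> grad L x + kappa/2 |y - x|\<^sup>2\<close>
  (\<open>aug_lagrangian_upper_model\<close>).  A block update minimizes the linear part of this model plus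
  the penalty \<open>|h|\<^sup>2 / (2 tau)\<close>, where \<open>h\<close> is the change of the block.  As \<open>h = 0\<close> is admissible, the
  linear part is at most \<open>-|h|\<^sup>2 / (2 tau)\<close>, which is at most \<open>-kappa |h|\<^sup>2\<close> because
  \<open>tau < 1/(2 kappa)\<close>.  Every block update therefore lowers \<open>L\<close> by at least \<open>kappa/2 |h|\<^sup>2\<close>, and
  adding this over the blocks of one sweep gives part (i) (\<open>bcd_sufficient_decrease\<close>).

  For part (ii), two distinct binary points are at distance at least 1, so every sweep that moves
  the iterate costs at least \<open>kappa/2\<close>.  The total cost is limited: by the quadratic model at
  \<open>x t\<close>, whose distance to \<open>x 0\<close> is at most \<open>sqrt n\<close>, one has
  \<open>L (x 0) - L (x t) \<le> C sqrt n + kappa n / 2\<close>.  Dividing bounds the number of moving sweeps by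
  \<open>N\<close> (\<open>card_costly_steps\<close>).  Hence the sequence is eventually constant, and one of the first
  \<open>N + 1\<close> sweeps leaves its point unchanged.  At such a point all block problems are solved by not
  moving, and with the same gradient; summed over the blocks their optimality conditions say that
  the point minimizes the proximal linear model over the whole feasible set.  On binary points the
  penalty \<open>|u - x|\<^sup>2\<close> coincides with the linear function \<open>(u - x) \<bullet> (1 - 2x)\<close> of \<open>u\<close>, which turns
  this condition into tau-stationarity (\<open>tau_stationary_if_sweep_fixed\<close>).
\<close>

section \<open>The quadratic upper model of the augmented Lagrangian\<close>

lemma norm_mult_le_spectral_norm:
  fixes A :: "real ^ 'n ^ 'm"
  shows "norm (A *v h) \<le> spectral_norm A * norm h"
  unfolding spectral_norm_def by (rule onorm[OF matrix_vector_mul_bounded_linear])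

text \<open>
  Half the squared positive part is a smooth function of each coordinate whose derivative
  \<open>max 0\<close> is 1-Lipschitz; this is the resulting second-order bound.
\<close>

lemma norm_pos_part_add_le:
  "(norm (pos_part (v + w)))\<^sup>2 \<le> (norm (pos_part v))\<^sup>2 + 2 * (w \<bullet> pos_part v) + (norm w)\<^sup>2"
proof -
  have coord: "(max 0 (a + e))\<^sup>2 \<le> (max 0 a)\<^sup>2 + 2 * (e * max 0 a) + e\<^sup>2" for a e :: real
  proof (cases "0 \<le> a")
    case True
    have "(max 0 (a + e))\<^sup>2 \<le> (a + e)\<^sup>2" by (simp add: max_def)
    then show ?thesis using True by (simp add: power2_sum algebra_simps)
  next
    case False
    then have "max 0 (a + e) \<le> \<bar>e\<bar>" by simp
    then have "(max 0 (a + e))\<^sup>2 \<le> \<bar>e\<bar>\<^sup>2" by (rule power_mono) simp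
    then show ?thesis using False by simp
  qed
  have "(\<Sum>i\<in>UNIV. (max 0 (v $ i + w $ i))\<^sup>2)
      \<le> (\<Sum>i\<in>UNIV. (max 0 (v $ i))\<^sup>2 + 2 * (w $ i * max 0 (v $ i)) + (w $ i)\<^sup>2)"
    by (rule sum_mono) (rule coord)
  then show ?thesis
    unfolding power2_norm_eq_inner
    by (simp add: inner_vec_def pos_part_def sum.distrib sum_distrib_left flip: power2_eq_square)
qed

lemma aug_lagrangian_upper_model:
  fixes A :: "real ^ 'n ^ 'm"
  assumes "0 \<le> rho"
  shows "aug_lagrangian c A b lam rho y \<le> aug_lagrangian c A b lam rho x
      + (y - x) \<bullet> grad (aug_lagrangian c A b lam rho) x
      + rho * (spectral_norm A)\<^sup>2 / 2 * (norm (y - x))\<^sup>2"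
proof -
  define h where "h = y - x"
  define r where "r = A *v x - b"
  have y: "A *v y - b = r + A *v h"
    by (simp add: h_def r_def matrix_vector_mult_diff_distrib)
  have adj: "h \<bullet> (v v* A) = (A *v h) \<bullet> v" for v
    using dot_lmul_matrix[of v A h] by (simp add: inner_commute)
  have "norm (A *v h) ^ 2 \<le> (spectral_norm A * norm h)\<^sup>2"
    by (rule power_mono[OF norm_mult_le_spectral_norm]) simp
  then have "(norm (pos_part (r + A *v h)))\<^sup>2
      \<le> (norm (pos_part r))\<^sup>2 + 2 * ((A *v h) \<bullet> pos_part r) + (spectral_norm A)\<^sup>2 * (norm h)\<^sup>2"
    using norm_pos_part_add_le[of r "A *v h"] by (simp add: power_mult_distrib)
  then have "rho / 2 * (norm (pos_part (r + A *v h)))\<^sup>2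
      \<le> rho / 2 * ((norm (pos_part r))\<^sup>2 + 2 * ((A *v h) \<bullet> pos_part r)
          + (spectral_norm A)\<^sup>2 * (norm h)\<^sup>2)"
    by (rule mult_left_mono) (use assms in simp)
  also have "\<dots> = rho / 2 * (norm (pos_part r))\<^sup>2 + rho * ((A *v h) \<bullet> pos_part r)
      + rho * (spectral_norm A)\<^sup>2 / 2 * (norm h)\<^sup>2"
    by (simp add: algebra_simps)
  finally have main: "rho / 2 * (norm (pos_part (r + A *v h)))\<^sup>2 \<le> \<dots>" .
  have "c \<bullet> y = c \<bullet> x + h \<bullet> c" by (simp add: h_def inner_diff_right inner_commute)
  moreover have "h \<bullet> grad (aug_lagrangian c A b lam rho) x
      = h \<bullet> c + lam \<bullet> (A *v h) + rho * ((A *v h) \<bullet> pos_part r)"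
    by (simp add: grad_aug_lagrangian r_def[symmetric] inner_add_right adj
        inner_commute[of lam])
  ultimately show ?thesis
    using main
    by (simp add: aug_lagrangian_def y r_def[symmetric] h_def[symmetric] inner_add_right)
qed

section \<open>Decomposition into blocks\<close>

lemma blockpart_diff: "blockpart blk j (u - v) = blockpart blk j u - blockpart blk j v"
  by (simp add: blockpart_def vec_eq_iff)

lemma inner_blockpart_cancel:
  "blockpart blk j u \<bullet> blockpart blk j v = blockpart blk j u \<bullet> v"
  unfolding blockpart_def inner_vec_def by (rule sum.cong) auto

lemma sum_blockpart:
  assumes "\<forall>i. blk i \<in> {1..p}"
  shows "(\<Sum>j=1..p. blockpart blk j u) = u"
proof -
  have "(\<Sum>j=1..p. if blk i = j then u $ i else 0) = u $ i" for i
    using assms by (simp add: sum.delta')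
  then show ?thesis by (simp add: vec_eq_iff blockpart_def)
qed

lemma sum_inner_blockpart:
  assumes "\<forall>i. blk i \<in> {1..p}"
  shows "(\<Sum>j=1..p. blockpart blk j u \<bullet> blockpart blk j v) = u \<bullet> v"
  by (simp only: inner_blockpart_cancel inner_sum_left[symmetric] sum_blockpart[OF assms])

lemma sum_norm_blockpart:
  assumes "\<forall>i. blk i \<in> {1..p}"
  shows "(\<Sum>j=1..p. (norm (blockpart blk j u))\<^sup>2) = (norm u)\<^sup>2"
  by (simp only: power2_norm_eq_inner sum_inner_blockpart[OF assms])

lemma partial_update_Suc:
  "partial_update blk (Suc j) y x = partial_update blk j y x + blockpart blk j (y - x)"
  by (auto simp: partial_update_def blockpart_def vec_eq_iff)

lemma partial_update_same: "partial_update blk j x x = x"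
  by (simp add: partial_update_def vec_eq_iff)

section \<open>Sufficient decrease\<close>

lemma bcd_block_optimal:
  assumes "bcd_prox_linear blk p S F tau x" and "j \<in> {1..p}" and "u \<in> S j"
  defines "g t \<equiv> blockpart blk j (grad F (partial_update blk j (x (Suc t)) (x t)))"
  shows "(blockpart blk j (x (Suc t)) - blockpart blk j (x t)) \<bullet> g t
        + 1 / (2 * tau) * (norm (blockpart blk j (x (Suc t)) - blockpart blk j (x t)))\<^sup>2
      \<le> (u - blockpart blk j (x t)) \<bullet> g t
        + 1 / (2 * tau) * (norm (u - blockpart blk j (x t)))\<^sup>2"
  using assms(1-3) unfolding g_def bcd_prox_linear_def is_arg_min_linorder by blast

text \<open>
  The sweep passes through the intermediate points \<open>partial_update blk j\<close> for
  \<open>j = 1, \<dots>, p + 1\<close>, which lead from the old to the new iterate.  Consecutive ones differ by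
  the change \<open>h\<close> of block \<open>j\<close>, and comparing the block minimizer with the old block bounds the
  linear term of the model of \<open>F\<close> by \<open>-|h|\<^sup>2 / (2 tau)\<close>.
\<close>

lemma bcd_sufficient_decrease:
  assumes blocks: "\<forall>i. blk i \<in> {1..p}"
    and model: "\<And>x y. F y \<le> F x + (y - x) \<bullet> grad F x + kappa / 2 * (norm (y - x))\<^sup>2"
    and bcd: "bcd_prox_linear blk p S F tau x"
    and old: "\<And>j. j \<in> {1..p} \<Longrightarrow> blockpart blk j (x t) \<in> S j"
    and tau: "kappa \<le> 1 / (2 * tau)"
  shows "kappa / 2 * (norm (x (Suc t) - x t))\<^sup>2 \<le> F (x t) - F (x (Suc t))"
proof -
  define P where "P j = partial_update blk j (x (Suc t)) (x t)" for j
  define h where "h j = blockpart blk j (x (Suc t) - x t)" for j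
  have step: "kappa / 2 * (norm (h j))\<^sup>2 \<le> F (P j) - F (P (Suc j))" if j: "j \<in> {1..p}" for j
  proof -
    have Pj: "P (Suc j) - P j = h j"
      by (simp add: P_def h_def partial_update_Suc)
    have "h j \<bullet> blockpart blk j (grad F (P j)) + 1 / (2 * tau) * (norm (h j))\<^sup>2 \<le> 0"
      using bcd_block_optimal[OF bcd j old[OF j], of t] by (simp add: P_def h_def blockpart_diff)
    then have lin: "h j \<bullet> grad F (P j) + 1 / (2 * tau) * (norm (h j))\<^sup>2 \<le> 0"
      by (simp add: h_def inner_blockpart_cancel)
    have "kappa * (norm (h j))\<^sup>2 \<le> 1 / (2 * tau) * (norm (h j))\<^sup>2"
      by (rule mult_right_mono[OF tau]) simp
    then show ?thesis
      using lin model[of "P (Suc j)" "P j"] unfolding Pj by linarith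
  qed
  have range: "blk i \<noteq> 0" "blk i \<le> p" for i using blocks by (auto dest: spec[of _ i])
  have ends: "P 1 = x t" "P (Suc p) = x (Suc t)"
    by (simp_all add: P_def partial_update_def vec_eq_iff less_Suc_eq_le range del: neq0_conv)
  have "kappa / 2 * (norm (x (Suc t) - x t))\<^sup>2 = (\<Sum>j=1..p. kappa / 2 * (norm (h j))\<^sup>2)"
    by (simp only: h_def sum_norm_blockpart[OF blocks] sum_distrib_left[symmetric])
  also have "\<dots> \<le> (\<Sum>j=1..p. F (P j) - F (P (Suc j)))"
    by (rule sum_mono) (rule step)
  also have "\<dots> = F (P 1) - F (P (Suc p))"
    using sum_Suc_diff[of 1 p "\<lambda>j. F (P j)"] by (simp add: sum_subtractf)
  finally show ?thesis unfolding ends .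
qed

section \<open>Binary points\<close>

lemma feasible_binary:
  assumes "\<forall>i. blk i \<in> {1..p}" and "x \<in> feasible blk p q B d"
  shows "x $ i \<in> {0, 1}"
proof -
  have "blockpart blk (blk i) x \<in> block_feasible blk q B d (blk i)"
    using assms by (auto simp: feasible_def)
  then have "blockpart blk (blk i) x $ i \<in> {0, 1}"
    unfolding block_feasible_def by blast
  then show ?thesis by (simp add: blockpart_def)
qed

lemma finite_feasible:
  assumes "\<forall>i. blk i \<in> {1..p}"
  shows "finite (feasible blk p q B d)"
proof (rule inj_on_finite)
  show "inj_on (\<lambda>x. {i. x $ i = 1}) (feasible blk p q B d)"
  proof (rule inj_onI)
    fix x y assume "x \<in> feasible blk p q B d" "y \<in> feasible blk p q B d"
    then have bin: "x $ i \<in> {0, 1}" "y $ i \<in> {0, 1}" for i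
      using feasible_binary[OF assms] by blast+
    assume "{i. x $ i = 1} = {i. y $ i = 1}"
    then have "x $ i = 1 \<longleftrightarrow> y $ i = 1" for i by blast
    then show "x = y" using bin by (metis empty_iff insert_iff vec_eq_iff)
  qed
qed (rule subset_UNIV, simp)

lemma binary_norm_diff_ge_1:
  fixes u v :: "real ^ 'n"
  assumes "\<And>i. u $ i \<in> {0, 1}" "\<And>i. v $ i \<in> {0, 1}" "u \<noteq> v"
  shows "1 \<le> norm (u - v)"
proof -
  obtain i where "u $ i \<noteq> v $ i" using assms(3) by (auto simp: vec_eq_iff)
  then have "\<bar>(u - v) $ i\<bar> = 1" using assms(1)[of i] assms(2)[of i] by auto
  then show ?thesis using component_le_norm_cart[of "u - v" i] by simp
qed

lemma binary_norm_diff_le: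
  fixes u v :: "real ^ 'n"
  assumes "\<And>i. u $ i \<in> {0, 1}" "\<And>i. v $ i \<in> {0, 1}"
  shows "norm (u - v) \<le> sqrt (real CARD('n))"
proof -
  have "(u $ i - v $ i) * (u $ i - v $ i) \<le> 1" for i
    using assms(1)[of i] assms(2)[of i] by auto
  then have "(\<Sum>i\<in>UNIV. (u $ i - v $ i) * (u $ i - v $ i)) \<le> (\<Sum>i\<in>(UNIV :: 'n set). 1)"
    by (rule sum_mono)
  then have "(norm (u - v))\<^sup>2 \<le> real CARD('n)"
    by (simp add: power2_norm_eq_inner inner_vec_def)
  then show ?thesis by (rule real_le_rsqrt)
qed

text \<open>
  The squares of the coordinates of a binary vector are the coordinates themselves, so the squared
  distance to a fixed binary point is affine.
\<close>

lemma binary_norm_diff_linear: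
  fixes u v :: "real ^ 'n"
  assumes "\<And>i. u $ i \<in> {0, 1}" "\<And>i. v $ i \<in> {0, 1}"
  shows "(norm (u - v))\<^sup>2 = (u - v) \<bullet> (1 - 2 *\<^sub>R v)"
proof -
  have "(u $ i - v $ i) * (u $ i - v $ i) = (u $ i - v $ i) * (1 - 2 * v $ i)" for i
    using assms(1)[of i] assms(2)[of i] by auto
  then have "(\<Sum>i\<in>UNIV. (u $ i - v $ i) * (u $ i - v $ i))
      = (\<Sum>i\<in>UNIV. (u $ i - v $ i) * (1 - 2 * v $ i))"
    by (rule sum.cong[OF refl])
  then show ?thesis by (simp add: power2_norm_eq_inner inner_vec_def del: mult_cancel_left)
qed

section \<open>Fixed points of a sweep\<close>

text \<open>
  If the sweep does not move \<open>x t\<close>, all its intermediate points equal \<open>x t\<close>, so the block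
  problems share the gradient at \<open>x t\<close>.  Their objectives are then the blocks of one separable
  function on the product set.
\<close>

lemma tau_stationary_if_sweep_fixed:
  assumes blocks: "\<forall>i. blk i \<in> {1..p}"
    and bcd: "bcd_prox_linear blk p (block_feasible blk q B d) F tau x"
    and feas: "x t \<in> feasible blk p q B d"
    and fixed: "x (Suc t) = x t"
    and tau: "0 < tau"
  shows "tau_stationary F (feasible blk p q B d) tau (x t)"
proof -
  define z where "z = x t"
  define g where "g = grad F z"
  have "0 \<le> (u - z) \<bullet> (tau *\<^sub>R g + (1 / 2) *\<^sub>R 1 - z)" if u: "u \<in> feasible blk p q B d" for u
  proof -
    have block: "0 \<le> blockpart blk j (u - z) \<bullet> blockpart blk j g
        + 1 / (2 * tau) * (norm (blockpart blk j (u - z)))\<^sup>2" if j: "j \<in> {1..p}" for j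
    proof -
      have "blockpart blk j u \<in> block_feasible blk q B d j"
        using u j by (auto simp: feasible_def)
      then show ?thesis
        using bcd_block_optimal[OF bcd j, of _ t]
        by (force simp: fixed partial_update_same z_def[symmetric] g_def[symmetric] blockpart_diff)
    qed
    have "0 \<le> (\<Sum>j=1..p. blockpart blk j (u - z) \<bullet> blockpart blk j g
        + 1 / (2 * tau) * (norm (blockpart blk j (u - z)))\<^sup>2)"
      by (rule sum_nonneg) (rule block)
    also have "\<dots> = (u - z) \<bullet> g + 1 / (2 * tau) * (norm (u - z))\<^sup>2"
      by (simp only: sum.distrib sum_distrib_left[symmetric] sum_inner_blockpart[OF blocks]
          sum_norm_blockpart[OF blocks])
    also have "(norm (u - z))\<^sup>2 = (u - z) \<bullet> (1 - 2 *\<^sub>R z)"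
      using feasible_binary[OF blocks] u feas
      by (intro binary_norm_diff_linear) (auto simp: z_def)
    finally have "0 \<le> tau * ((u - z) \<bullet> g + 1 / (2 * tau) * ((u - z) \<bullet> (1 - 2 *\<^sub>R z)))"
      using tau by simp
    also have "\<dots> = (u - z) \<bullet> (tau *\<^sub>R g + (1 / 2) *\<^sub>R 1 - z)"
      using tau by (simp add: inner_diff_right inner_add_right field_simps)
    finally show ?thesis .
  qed
  then show ?thesis
    using feas
    unfolding tau_stationary_def linear_argmin_def is_arg_min_linorder z_def[symmetric]
      g_def[symmetric]
    by (auto simp: inner_diff_left inner_commute)
qed

section \<open>Counting the moving sweeps\<close>

text \<open>
  A budget argument: \<open>f\<close> never increases, loses at least \<open>e\<close> at every step satisfying \<open>M\<close>,
  and loses at most \<open>K\<close> altogether.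
\<close>

lemma card_costly_steps:
  fixes f :: "nat \<Rightarrow> real"
  assumes e: "0 < e"
    and dec: "\<And>t. f (Suc t) \<le> f t"
    and cost: "\<And>t. M t \<Longrightarrow> e \<le> f t - f (Suc t)"
    and budget: "\<And>t. f 0 - f t \<le> K"
  shows "finite {t. M t}" and "e * real (card {t. M t}) \<le> K"
proof -
  have bound: "e * real (card G) \<le> K" if G: "finite G" "G \<subseteq> {t. M t}" for G
  proof -
    obtain n where n: "G \<subseteq> {..<n}" using finite_nat_iff_bounded G(1) by blast
    have "e * real (card G) = (\<Sum>t\<in>G. e)" by simp
    also have "\<dots> \<le> (\<Sum>t\<in>G. f t - f (Suc t))" by (rule sum_mono) (use G cost in auto)
    also have "\<dots> \<le> (\<Sum>t<n. f t - f (Suc t))" by (rule sum_mono2) (use n dec in auto)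
    also have "\<dots> = f 0 - f n" by (rule sum_lessThan_telescope')
    finally show ?thesis using budget[of n] by linarith
  qed
  have "card G \<le> nat \<lceil>K / e\<rceil>" if "G \<subseteq> {t. M t}" "finite G" for G
  proof -
    have "real (card G) \<le> K / e" using bound[OF that(2,1)] e by (simp add: field_simps)
    then show ?thesis by linarith
  qed
  then show "finite {t. M t}"
    using finite_if_finite_subsets_card_bdd by blast
  then show "e * real (card {t. M t}) \<le> K" by (rule bound) simp
qed

lemma ex_not_if_card_le:
  fixes N :: nat
  assumes "finite {t. M t}" "card {t. M t} \<le> N"
  shows "\<exists>T\<le>N. \<not> M T"
proof (rule ccontr)
  assume "\<not> ?thesis"
  then have "{..N} \<subseteq> {t. M t}" by auto
  then have "card {..N} \<le> card {t. M t}" by (rule card_mono[OF assms(1)])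
  then show False using assms(2) by simp
qed

lemma eventually_constant_if_finite_moves:
  assumes "finite {t::nat. x (Suc t) \<noteq> x t}"
  obtains n where "\<And>t. n \<le> t \<Longrightarrow> x t = x n"
proof -
  obtain n where n: "{t. x (Suc t) \<noteq> x t} \<subseteq> {..<n}" using finite_nat_iff_bounded assms by blast
  have "x t = x n" if "n \<le> t" for t
    using that
  proof (induction t rule: dec_induct)
    case (step t)
    then have "t \<notin> {..<n}" by simp
    then have "x (Suc t) = x t" using n by blast
    then show ?case using step.IH by simp
  qed simp
  then show ?thesis by (rule that)
qed

section \<open>Convergence of the block coordinate descent method\<close>

theorem theorem4p2:
  fixes c :: "real ^ 'n" and A :: "real ^ 'n ^ 'm" and b lam :: "real ^ 'm"
    and blk :: "'n \<Rightarrow> nat" and p :: nat and q :: "nat \<Rightarrow> nat"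
    and B :: "nat \<Rightarrow> nat \<Rightarrow> real ^ 'n" and d :: "nat \<Rightarrow> nat \<Rightarrow> real"
    and rho tau kappa C :: real and x :: "nat \<Rightarrow> real ^ 'n"
    and X :: "(real ^ 'n) set" and L :: "real ^ 'n \<Rightarrow> real" and N :: nat
  defines "X \<equiv> feasible blk p q B d"
    and "L \<equiv> aug_lagrangian c A b lam rho"
    and "kappa \<equiv> rho * (spectral_norm A)\<^sup>2"
    and "C \<equiv> Max ((\<lambda>y. norm (grad L y)) ` X)"
    and "N \<equiv> nat \<lceil>(2 * C * sqrt (real CARD('n)) + kappa * real CARD('n)) / kappa\<rceil>"
  assumes blocks: "\<forall>i. blk i \<in> {1..p}"
    and nonempty: "X \<noteq> {}"
    and lam: "\<forall>i. 0 \<le> lam $ i"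
    and rho: "0 < rho"
    and start: "x 0 \<in> X"
    and bcd: "bcd_prox_linear blk p (block_feasible blk q B d) L tau x"
    and tau: "0 < tau" "tau < 1 / (2 * kappa)"
  shows "(decseq (\<lambda>t. L (x t)) \<and>
          (\<forall>t. kappa / 2 * (norm (x (Suc t) - x t))\<^sup>2 \<le> L (x t) - L (x (Suc t)))) \<and>
         (\<exists>xs. tau_stationary L X tau xs \<and> x \<longlonglongrightarrow> xs \<and>
           finite {t. x (Suc t) \<noteq> x t} \<and> card {t. x (Suc t) \<noteq> x t} \<le> N \<and>
           (\<exists>T\<le>N. x (Suc T) = x T \<and> tau_stationary L X tau (x T)) \<and>
           ((\<forall>t. x (Suc t) = x t \<longrightarrow> x (Suc (Suc t)) = x (Suc t)) \<longrightarrow> (\<forall>t\<ge>N. x t = xs)))"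
proof -
  have kappa: "0 < kappa"
  proof -
    have "0 < 1 / (2 * kappa)" using tau by linarith
    then show ?thesis by (simp add: zero_less_divide_iff)
  qed
  have kappa_tau: "kappa \<le> 1 / (2 * tau)"
    using tau kappa by (simp add: field_simps)
  have model: "L y \<le> L z + (y - z) \<bullet> grad L z + kappa / 2 * (norm (y - z))\<^sup>2" for y z
    unfolding L_def kappa_def by (rule aug_lagrangian_upper_model) (use rho in simp)
  have feas: "x t \<in> X" for t
  proof (cases t)
    case 0
    then show ?thesis using start by simp
  next
    case (Suc s)
    then show ?thesis
      using bcd by (auto simp: X_def feasible_def bcd_prox_linear_def is_arg_min_linorder)
  qed
  have binary: "x t $ i \<in> {0, 1}" for t i
    using feasible_binary[OF blocks] feas X_def by blast
  have decrease: "kappa / 2 * (norm (x (Suc t) - x t))\<^sup>2 \<le> L (x t) - L (x (Suc t))" for t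
    by (rule bcd_sufficient_decrease[OF blocks model bcd _ kappa_tau])
      (use feas[of t] in \<open>auto simp: X_def feasible_def\<close>)
  have L_le: "L (x (Suc t)) \<le> L (x t)" for t
  proof -
    have "0 \<le> kappa / 2 * (norm (x (Suc t) - x t))\<^sup>2" using kappa by simp
    then show ?thesis using decrease[of t] by linarith
  qed

  have moving: "kappa / 2 \<le> L (x t) - L (x (Suc t))" if "x (Suc t) \<noteq> x t" for t
  proof -
    have "1 \<le> (norm (x (Suc t) - x t))\<^sup>2"
      using binary_norm_diff_ge_1[OF binary binary that] by simp
    then have "kappa / 2 * 1 \<le> kappa / 2 * (norm (x (Suc t) - x t))\<^sup>2"
      by (rule mult_left_mono) (use kappa in simp)
    then show ?thesis using decrease[of t] by linarith
  qed
  have budget: "L (x 0) - L (x t) \<le> C * sqrt (real CARD('n)) + kappa / 2 * real CARD('n)" for t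
  proof -
    have dist: "norm (x 0 - x t) \<le> sqrt (real CARD('n))"
      by (rule binary_norm_diff_le) (rule binary)+
    have "norm (grad L (x t)) \<le> C"
      unfolding C_def using finite_feasible[OF blocks] feas by (auto simp: X_def)
    then have "(x 0 - x t) \<bullet> grad L (x t) \<le> C * sqrt (real CARD('n))"
      using norm_cauchy_schwarz[of "x 0 - x t" "grad L (x t)"] dist
        mult_mono[of "norm (x 0 - x t)" "sqrt (real CARD('n))" "norm (grad L (x t))" C]
      by (simp add: mult.commute)
    moreover have "(norm (x 0 - x t))\<^sup>2 \<le> real CARD('n)"
      using power_mono[OF dist, of 2] by simp
    then have "kappa / 2 * (norm (x 0 - x t))\<^sup>2 \<le> kappa / 2 * real CARD('n)"
      by (rule mult_left_mono) (use kappa in simp)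
    ultimately show ?thesis using model[of "x 0" "x t"] by linarith
  qed
  note count = card_costly_steps[where f = "\<lambda>t. L (x t)" and e = "kappa / 2"
      and M = "\<lambda>t. x (Suc t) \<noteq> x t", OF _ L_le moving budget]
  have fin: "finite {t. x (Suc t) \<noteq> x t}" using count(1) kappa by simp
  have card: "card {t. x (Suc t) \<noteq> x t} \<le> N"
  proof -
    have "real (card {t. x (Suc t) \<noteq> x t})
        \<le> (2 * C * sqrt (real CARD('n)) + kappa * real CARD('n)) / kappa"
      using count(2) kappa by (simp add: field_simps)
    then show ?thesis unfolding N_def by linarith
  qed

  have stat: "tau_stationary L X tau (x t)" if "x (Suc t) = x t" for t
    unfolding X_def
    by (rule tau_stationary_if_sweep_fixed[OF blocks bcd _ that tau(1)])
      (use feas in \<open>simp add: X_def\<close>)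
  obtain T where T: "T \<le> N" "x (Suc T) = x T" using ex_not_if_card_le[OF fin card] by auto
  obtain n where n: "\<And>t. n \<le> t \<Longrightarrow> x t = x n"
    using eventually_constant_if_finite_moves[OF fin] by blast
  have "x \<longlonglongrightarrow> x n"
    by (rule tendsto_eventually) (use n eventually_sequentially in blast)
  moreover have "tau_stationary L X tau (x n)" using stat n[of "Suc n"] by simp
  \<comment> \<open>When a block problem has several minimizers, the sequence may rest for one sweep and move
    later, so reaching the limit by time \<open>N\<close> requires that a resting sequence keeps resting.\<close>
  moreover have "x t = x n"
    if stay: "\<forall>t. x (Suc t) = x t \<longrightarrow> x (Suc (Suc t)) = x (Suc t)" and t: "N \<le> t" for t
  proof -
    have "x (Suc s) = x s \<and> x s = x T" if "T \<le> s" for s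
      using that
    proof (induction s rule: dec_induct)
      case base
      show ?case using T by simp
    next
      case (step s)
      then show ?case using stay by metis
    qed
    then have const: "x s = x T" if "T \<le> s" for s using that by blast
    have "x t = x T" by (rule const) (use T(1) t in simp)
    also have "\<dots> = x (max n T)" using const[of "max n T"] by simp
    also have "\<dots> = x n" by (rule n) simp
    finally show ?thesis .
  qed
  moreover have "\<exists>T\<le>N. x (Suc T) = x T \<and> tau_stationary L X tau (x T)"
    using T stat by blast
  moreover have "decseq (\<lambda>t. L (x t))" unfolding decseq_Suc_iff using L_le by blast
  ultimately show ?thesis using decrease fin card by blast
qed

end
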